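(* Every transitive game with activeness is canonical.
   Context: Let $\mathcal{B}=\{0,1\}$. Define $\mathbb{I}_0=\{\emptyset\}\times\mathcal{B}$ and $\mathbb{I}_n=2^{\mathbb{I}_{n-1}}\times\mathcal{B}$ for $n\ge1$; a game with activeness is an element of $\mathbb{I}=\bigcup_{n\ge0}\mathbb{I}_n$. A pair $(G,g)$ is written $G^g$; elements of $G$ are its options, $g=1$ meaning active. The outcome $o$ is defined recursively: $o(G^g)=\mathscr{N}$ if $g=1$ and some option has outcome $\mathscr{P}$, and $o(G^g)=\mathscr{P}$ otherwise. The sum is $G^g+H^h=(\{G'^{g'}+H^h:G'^{g'}\in G^g\}\cup\{G^g+H'^{h'}:H'^{h'}\in H^h\})^{\max\{g,h\}}$. $G^g=H^h$ means $o(G^g+X^x)=o(H^h+X^x)$ for all games $X^x$. An option $G'^{g'}$ of $G^g$ is reversible if some $G''^{g''}\in G'^{g'}$ satisfies $G''^{g''}=G^g$; a game is canonical (recursively) if all its options are canonical and none of its options is reversible. A game $G^g$ is transitive (recursively) if every option of $G^g$ is transitive and $G'\subseteq G$ for every option $G'^{g'}\in G^g$. *)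

theory Defs
  imports Main "HOL-Library.FSet"
begin

text \<open>
  Every level \<open>\<I>\<^sub>n\<close> is a finite set, so a game with activeness is a hereditarily finite
  set of options carrying an activeness flag; this is the datatype below. The lemma
  \<open>Union_game_level\<close> confirms that the union of the levels is the whole type.
\<close>

datatype game = Game (options: "game fset") (active: bool)

primrec game_level :: "nat \<Rightarrow> game set" where
  "game_level 0 = {Game {||} b | b. True}"
| "game_level (Suc n) = {Game A b | A b. fset A \<subseteq> game_level n}"

lemma game_level_mono: "m \<le> n \<Longrightarrow> game_level m \<subseteq> game_level n"
proof (rule lift_Suc_mono_le[of game_level])
  fix n show "game_level n \<subseteq> game_level (Suc n)"
    by (induction n) force+
qed auto

lemma Union_game_level: "(\<Union>n. game_level n) = UNIV"
proof -
  have "\<exists>n. X \<in> game_level n" for X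
  proof (induction X)
    case (Game G g)
    then obtain f where f: "\<And>X. X \<in> fset G \<Longrightarrow> X \<in> game_level (f X)" by metis
    have "fset G \<subseteq> game_level (Max (f ` fset G))"
    proof
      fix X assume X: "X \<in> fset G"
      then have "f X \<le> Max (f ` fset G)" by simp
      with f[OF X] game_level_mono show "X \<in> game_level (Max (f ` fset G))" by blast
    qed
    then have "Game G g \<in> game_level (Suc (Max (f ` fset G)))" by simp
    then show ?case by blast
  qed
  then show ?thesis by blast
qed

lemma size_option: "X |\<in>| G \<Longrightarrow> size X < size (Game G g)"
  using member_le_sum[of X "fset G" "\<lambda>Y. Suc (size Y)"] by simp

declare fimage_cong [fundef_cong]

datatype outcome_class = N_position | P_position

function outcome :: "game \<Rightarrow> outcome_class" where
  "outcome (Game G g) = (if g \<and> (\<exists>G' \<in> fset G. outcome G' = P_position) then N_position else P_position)"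
  by pat_completeness auto
termination
  by (relation "measure size") (auto dest: size_option)

function gsum :: "game \<Rightarrow> game \<Rightarrow> game"  (infixl "\<oplus>" 65) where
  "Game G g \<oplus> Game H h =
     Game ((\<lambda>G'. G' \<oplus> Game H h) |`| G |\<union>| (\<lambda>H'. Game G g \<oplus> H') |`| H) (g \<or> h)"
  by pat_completeness auto
termination
  by (relation "measure (\<lambda>(X, Y). size X + size Y)") (auto dest: size_option)

definition game_eq :: "game \<Rightarrow> game \<Rightarrow> bool"  (infix "\<doteq>" 50) where
  "G \<doteq> H \<longleftrightarrow> (\<forall>X. outcome (G \<oplus> X) = outcome (H \<oplus> X))"

definition reversible :: "game \<Rightarrow> game \<Rightarrow> bool" where
  "reversible G' G \<longleftrightarrow> (\<exists>G'' \<in> fset (options G'). G'' \<doteq> G)"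

function canonical :: "game \<Rightarrow> bool" where
  "canonical (Game G g) \<longleftrightarrow>
     (\<forall>G' \<in> fset G. canonical G') \<and> (\<forall>G' \<in> fset G. \<not> reversible G' (Game G g))"
  by pat_completeness auto
termination
  by (relation "measure size") (auto dest: size_option)

function transitive :: "game \<Rightarrow> bool" where
  "transitive (Game G g) \<longleftrightarrow>
     (\<forall>G' \<in> fset G. transitive G') \<and> (\<forall>G' \<in> fset G. options G' |\<subseteq>| G)"
  by pat_completeness auto
termination
  by (relation "measure size") (auto dest: size_option)

end

theory Submission
  imports Defs
begin

text \<open>
  Let \<open>activate X\<close> be \<open>X\<close> with every position made active. The sum of \<open>X\<close> and \<open>activate X\<close> is
  active at every stage, so the mirroring strategy shows that it is a P-position. Hence
  if \<open>X\<close> is an option of \<open>G\<close>, then \<open>G \<oplus> activate X\<close> is an N-position, and \<open>activate X\<close>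
  distinguishes \<open>X\<close> from \<open>G\<close>: no game equals one of its own options. In a transitive game, an
  option of an option is again an option, so no option is reversible.
\<close>

primrec activate :: "game \<Rightarrow> game" where
  "activate (Game G g) = Game (activate |`| G) True"

lemma active_activate [simp]: "active (activate X)"
  by (cases X) simp

lemma options_activate [simp]: "options (activate X) = activate |`| options X"
  by (cases X) simp

lemma active_gsum [simp]: "active (X \<oplus> Y) \<longleftrightarrow> active X \<or> active Y"
  by (cases X; cases Y) simp

lemma options_gsum [simp]:
  "options (X \<oplus> Y) = (\<lambda>X'. X' \<oplus> Y) |`| options X |\<union>| (\<lambda>Y'. X \<oplus> Y') |`| options Y"
  by (cases X; cases Y) simp

lemma outcome_eq_N_iff:
  "outcome X = N_position \<longleftrightarrow> active X \<and> (\<exists>X' |\<in>| options X. outcome X' = P_position)"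
  by (cases X) simp

lemma outcome_eq_P_iff:
  "outcome X = P_position \<longleftrightarrow> \<not> active X \<or> (\<forall>X' |\<in>| options X. outcome X' = N_position)"
  using outcome_eq_N_iff[of X] by (metis outcome_class.distinct(1) outcome_class.exhaust)

lemma outcome_gsum_activate: "outcome (X \<oplus> activate X) = P_position"
proof (induction X)
  case (Game G g)
  \<comment> \<open>The reply to a move in either summand is the matching move in the other. It
    reaches \<open>X' \<oplus> activate X'\<close>, a P-position by induction, and is allowed
    because the second summand is always active.\<close>
  have "outcome (X' \<oplus> activate (Game G g)) = N_position" if "X' |\<in>| G" for X'
    unfolding outcome_eq_N_iff using Game[OF that] that by auto
  moreover have "outcome (Game G g \<oplus> activate X') = N_position" if "X' |\<in>| G" for X'
    unfolding outcome_eq_N_iff using Game[OF that] that by auto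
  ultimately show ?case
    unfolding outcome_eq_P_iff by auto
qed

lemma option_not_game_eq:
  assumes "X |\<in>| options G"
  shows "\<not> X \<doteq> G"
proof
  assume "X \<doteq> G"
  then have "outcome (G \<oplus> activate X) = P_position"
    using outcome_gsum_activate[of X] by (simp add: game_eq_def)
  \<comment> \<open>The winning move takes \<open>G\<close> to its option \<open>X\<close>.\<close>
  moreover have "outcome (G \<oplus> activate X) = N_position"
    unfolding outcome_eq_N_iff using assms outcome_gsum_activate by auto
  ultimately show False by simp
qed

theorem theorem3p45:
  fixes G :: game
  assumes "transitive G"
  shows "canonical G"
  using assms
proof (induction G)
  case (Game G g)
  \<comment> \<open>The wildcard stands for the option of \<open>G'\<close> that would witness
    reversibility; transitivity puts it in \<open>G\<close>.\<close>
  have "\<not> reversible G' (Game G g)" if "G' |\<in>| G" for G'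
    using Game.prems that option_not_game_eq[of _ "Game G g"]
    by (auto simp: reversible_def)
  with Game show ?case by simp
qed

end
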